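(* Let $F$ be a tight graph on $N$ vertices, let $T$ be a triangle of $F$, and let $t\ge1$ be an integer. Let $G$ be the blow-up of $F$ in which the three vertices of $T$ are replaced by independent sets of size $t+1$ and every other vertex by an independent set of size $t$. Then $n:=|V(G)|=Nt+3$ and $$e(G)=\left\lfloor\frac{n^2}4\right\rfloor+1,\qquad \operatorname{bk}(G)=\left\lfloor\frac n6\right\rfloor+1,\qquad \lambda(G)>\lambda(T_{n,2}).$$
   Context: Graphs are finite and simple. $e(G)$ is the number of edges and $\lambda(G)$ the spectral radius of the adjacency matrix of $G$. The booksize is $\operatorname{bk}(G)=\max_{uv\in E(G)}|N(u)\cap N(v)|$, the maximum number of triangles sharing a common edge. $T_{n,2}$ is the balanced complete bipartite graph on $n$ vertices, with parts of sizes $\lfloor n/2\rfloor$ and $\lceil n/2\rceil$. A graph $F$ on $N$ vertices is tight if $F$ is $\frac N2$-regular, $F$ contains a triangle, and every edge of $F$ lies in either $0$ or exactly $\frac N6$ triangles. The blow-up of a graph $F$ with respect to nonnegative integers $(w_v)_{v\in V(F)}$ is obtained by replacing each vertex $v$ by an independent set of size $w_v$ and joining two new vertices exactly when the corresponding vertices of $F$ are adjacent. *)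

theory Defs
  imports
    "Graph_Theory.Kuratowski"
    "Jordan_Normal_Form.Spectral_Radius"
begin

text \<open>
  Finite simple graphs are the structures satisfying \<^locale>\<open>pair_graph\<close>: a finite vertex set
  with a symmetric irreflexive arc set, so that an undirected edge \<open>uv\<close> is represented by the
  two arcs \<open>(u,v)\<close> and \<open>(v,u)\<close>.
\<close>

definition neighbourhood :: "'a pair_pre_digraph \<Rightarrow> 'a \<Rightarrow> 'a set" where
  "neighbourhood G v = {u. (v, u) \<in> parcs G}"

definition edge_set :: "'a pair_pre_digraph \<Rightarrow> 'a set set" where
  "edge_set G = {{u, v} | u v. (u, v) \<in> parcs G}"

definition num_edges :: "'a pair_pre_digraph \<Rightarrow> nat" where
  "num_edges G = card (edge_set G)"

text \<open>A maximum over the edges; unspecified for edgeless graphs.\<close>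

definition booksize :: "'a pair_pre_digraph \<Rightarrow> nat" where
  "booksize G = Max ((\<lambda>(u, v). card (neighbourhood G u \<inter> neighbourhood G v)) ` parcs G)"

definition is_triangle :: "'a pair_pre_digraph \<Rightarrow> 'a set \<Rightarrow> bool" where
  "is_triangle G T \<longleftrightarrow> T \<subseteq> pverts G \<and> card T = 3 \<and>
     (\<forall>u\<in>T. \<forall>v\<in>T. u \<noteq> v \<longrightarrow> (u, v) \<in> parcs G)"

text \<open>
  The quotients \<open>N/2\<close> and \<open>N/6\<close> are exact (real) ones: in a graph with an edge in a triangle
  the condition forces \<open>6\<close> to divide \<open>N\<close>.
\<close>

definition tight :: "'a pair_pre_digraph \<Rightarrow> bool" where
  "tight F \<longleftrightarrow>
     (\<forall>v\<in>pverts F. real (card (neighbourhood F v)) = real (card (pverts F)) / 2) \<and>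
     (\<exists>T. is_triangle F T) \<and>
     (\<forall>e\<in>edge_set F. card {T. is_triangle F T \<and> e \<subseteq> T} = 0 \<or>
        real (card {T. is_triangle F T \<and> e \<subseteq> T}) = real (card (pverts F)) / 6)"

definition blow_up :: "'a pair_pre_digraph \<Rightarrow> ('a \<Rightarrow> nat) \<Rightarrow> ('a \<times> nat) pair_pre_digraph" where
  "blow_up F w =
     \<lparr> pverts = (SIGMA v:pverts F. {..<w v}),
       parcs = {((u, i), (v, j)) | u i v j. (u, v) \<in> parcs F \<and> i < w u \<and> j < w v} \<rparr>"

lemma pair_graph_blow_up:
  assumes "pair_graph F"
  shows "pair_graph (blow_up F w)"
proof -
  interpret pair_graph F by fact
  have fin: "finite (pverts (blow_up F w))"
    using pair_finite_verts by (auto simp: blow_up_def)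
  have sub: "parcs (blow_up F w) \<subseteq> pverts (blow_up F w) \<times> pverts (blow_up F w)"
    by (auto simp: blow_up_def dest: in_arcsD1 in_arcsD2)
  have sym: "sym (parcs F)"
    using pair_sym_arcs by (simp add: symmetric_def)
  show ?thesis
  proof unfold_locales
    show "finite (parcs (blow_up F w))"
      using finite_subset[OF sub] fin by blast
    show "symmetric (with_proj (blow_up F w))"
      using sym by (auto simp: symmetric_def blow_up_def sym_def)
    show "fst e \<noteq> snd e" if "e \<in> parcs (blow_up F w)" for e
      using that by (auto simp: blow_up_def dest: pair_no_loops)
  qed (use fin sub in auto)
qed

text \<open>\<open>T\<^bsub>n,2\<^esub>\<close> on the vertices \<open>0, \<dots>, n - 1\<close>, the first \<open>n div 2\<close> of which form one part.\<close>

definition turan2 :: "nat \<Rightarrow> nat pair_pre_digraph" where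
  "turan2 n =
     \<lparr> pverts = {..<n},
       parcs = {..<n div 2} \<times> {n div 2..<n} \<union> {n div 2..<n} \<times> {..<n div 2} \<rparr>"

lemma turan2_complete_bipartite: "K\<^bsub>n div 2, n - n div 2\<^esub> (with_proj (turan2 n))"
proof -
  have "{..<n} = {..<n div 2} \<union> {n div 2..<n}"
    by (rule ivl_disj_un_one(2)[symmetric]) simp
  moreover have "{..<n div 2} \<inter> {n div 2..<n} = {}"
    by (rule ivl_disj_int_one(2))
  ultimately show ?thesis
    unfolding complete_bipartite_digraph_pair_def turan2_def
    by (metis pair_pre_digraph.select_convs card_atLeastLessThan card_lessThan finite_lessThan)
qed

text \<open>
  The adjacency matrix depends on an enumeration \<open>vs\<close> of the vertices, its spectrum does not
  (see \<open>eigenvalue_adjacency_mat\<close>), so the choice made in \<open>graph_spectral_radius\<close> is immaterial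
  (see \<open>graph_spectral_radius_eq\<close>).
\<close>

definition adjacency_mat :: "'a pair_pre_digraph \<Rightarrow> 'a list \<Rightarrow> complex mat" where
  "adjacency_mat G vs =
     mat (length vs) (length vs) (\<lambda>(i, j). if (vs ! i, vs ! j) \<in> parcs G then 1 else 0)"

definition graph_spectral_radius :: "'a pair_pre_digraph \<Rightarrow> real" where
  "graph_spectral_radius G =
     spectral_radius (adjacency_mat G (SOME vs. distinct vs \<and> set vs = pverts G))"

lemma eigenvalue_adjacency_mat:
  assumes "distinct vs"
  shows "eigenvalue (adjacency_mat G vs) k \<longleftrightarrow>
    (\<exists>f. (\<exists>v\<in>set vs. f v \<noteq> 0) \<and>
      (\<forall>v\<in>set vs. (\<Sum>u\<in>set vs. if (v, u) \<in> parcs G then f u else 0) = k * f v))"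
    (is "?L \<longleftrightarrow> ?R")
proof -
  let ?n = "length vs"
  have bij: "bij_betw ((!) vs) {0..<?n} (set vs)"
    using assms by (auto intro: bij_betw_nth)
  have mult: "(adjacency_mat G vs *\<^sub>v vec ?n (\<lambda>i. f (vs ! i))) $ i =
      (\<Sum>u\<in>set vs. if (vs ! i, u) \<in> parcs G then f u else 0)" if "i < ?n" for i f
    using that
    by (auto simp: adjacency_mat_def scalar_prod_def sum.reindex_bij_betw[OF bij, symmetric]
        intro!: sum.cong)
  have eig: "eigenvector (adjacency_mat G vs) (vec ?n (\<lambda>i. f (vs ! i))) k \<longleftrightarrow>
      (\<exists>v\<in>set vs. f v \<noteq> 0) \<and>
      (\<forall>v\<in>set vs. (\<Sum>u\<in>set vs. if (v, u) \<in> parcs G then f u else 0) = k * f v)" for f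
  proof -
    have dim: "dim_row (adjacency_mat G vs) = ?n" by (simp add: adjacency_mat_def)
    have nz: "vec ?n (\<lambda>i. f (vs ! i)) \<noteq> 0\<^sub>v ?n \<longleftrightarrow> (\<exists>v\<in>set vs. f v \<noteq> 0)"
      by (auto simp: vec_eq_iff set_conv_nth)
    have "adjacency_mat G vs *\<^sub>v vec ?n (\<lambda>i. f (vs ! i)) = k \<cdot>\<^sub>v vec ?n (\<lambda>i. f (vs ! i)) \<longleftrightarrow>
      (\<forall>i<?n. (adjacency_mat G vs *\<^sub>v vec ?n (\<lambda>i. f (vs ! i))) $ i = k * f (vs ! i))"
      using dim by (auto simp: vec_eq_iff simp del: index_mult_mat_vec)
    also have "\<dots> \<longleftrightarrow>
      (\<forall>i<?n. (\<Sum>u\<in>set vs. if (vs ! i, u) \<in> parcs G then f u else 0) = k * f (vs ! i))"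
      by (simp only: mult cong: imp_cong)
    also have "\<dots> \<longleftrightarrow>
      (\<forall>v\<in>set vs. (\<Sum>u\<in>set vs. if (v, u) \<in> parcs G then f u else 0) = k * f v)"
      by (rule all_set_conv_all_nth[symmetric])
    finally show ?thesis
      by (simp only: eigenvector_def dim nz vec_carrier simp_thms)
  qed
  show ?thesis
  proof
    assume ?L
    then obtain x where x: "eigenvector (adjacency_mat G vs) x k"
      by (auto simp: eigenvalue_def)
    then have "dim_vec x = ?n"
      by (auto simp: eigenvector_def adjacency_mat_def)
    moreover define g where "g = (\<lambda>v. x $ inv_into {0..<?n} ((!) vs) v)"
    ultimately have "x = vec ?n (\<lambda>i. g (vs ! i))"
      using bij by (auto simp: vec_eq_iff bij_betw_def)
    then show ?R
      using eig[of g] x by (intro exI[of _ g]) simp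
  next
    assume ?R
    then obtain f where "eigenvector (adjacency_mat G vs) (vec ?n (\<lambda>i. f (vs ! i))) k"
      unfolding eig[symmetric] by (rule exE)
    then show ?L
      unfolding eigenvalue_def by (rule exI)
  qed
qed

lemma graph_spectral_radius_eq:
  assumes "distinct vs" "set vs = pverts G"
  shows "graph_spectral_radius G = spectral_radius (adjacency_mat G vs)"
proof -
  define us where "us = (SOME us. distinct us \<and> set us = pverts G)"
  have "distinct us \<and> set us = pverts G"
    unfolding us_def by (rule someI[of _ vs]) (use assms in simp)
  then have "eigenvalue (adjacency_mat G us) k = eigenvalue (adjacency_mat G vs) k" for k
    using assms eigenvalue_adjacency_mat[of us G k] eigenvalue_adjacency_mat[of vs G k] by simp
  then have "spectrum (adjacency_mat G us) = spectrum (adjacency_mat G vs)"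
    unfolding spectrum_def by (rule Collect_cong)
  then show ?thesis
    by (simp add: graph_spectral_radius_def spectral_radius_def flip: us_def)
qed

end

theory Submission
  imports Defs
begin

text \<open>
  Let \<open>m = N/6\<close>. Inclusion-exclusion shows that the three vertices of a triangle of \<open>F\<close> have no
  common neighbour, so an edge of \<open>F\<close> has at most one common neighbour in \<open>T\<close> and the booksize is
  \<open>m t + 1\<close>. Counting arcs gives \<open>n = 6 m t + 3\<close> and \<open>2 e(G) = (n\<^sup>2 + 3) / 2\<close>. Hence the average degree
  \<open>2 e(G) / n\<close>, a lower bound of \<open>\<lambda>(G)\<close>, exceeds \<open>n / 2 \<ge> \<lambda>(T\<^bsub>n,2\<^esub>)\<close>. The spectral radius dominates
  Rayleigh quotients of a symmetric matrix because, by Cauchy-Schwarz, a quotient above \<open>1\<close> makes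
  the quadratic forms of the powers \<open>B\<^bsup>2^j\<^esup>\<close> grow without bound, whereas powers of a matrix of
  spectral radius below \<open>1\<close> are bounded.
\<close>

section \<open>Rayleigh quotients and the spectral radius\<close>

lemma pow_mat_add:
  assumes "A \<in> carrier_mat n n"
  shows "A ^\<^sub>m (k + m) = A ^\<^sub>m k * A ^\<^sub>m m"
proof (induction m)
  case 0
  then show ?case using assms by simp
next
  case (Suc m)
  then show ?case
    using assms assoc_mult_mat[of "A ^\<^sub>m k" n n "A ^\<^sub>m m" n A n] by simp
qed

lemma transpose_pow_mat:
  fixes A :: "'a :: comm_semiring_1 mat"
  assumes A: "A \<in> carrier_mat n n" and sym: "A\<^sup>T = A"
  shows "(A ^\<^sub>m k)\<^sup>T = A ^\<^sub>m k"
proof (induction k)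
  case 0
  then show ?case by simp
next
  case (Suc k)
  have "(A ^\<^sub>m Suc k)\<^sup>T = A * A ^\<^sub>m k"
    using A Suc sym transpose_mult[of "A ^\<^sub>m k" n n A n] by simp
  also have "\<dots> = A ^\<^sub>m Suc k"
    using pow_mat_add[OF A, of 1 k] A by simp
  finally show ?case .
qed

lemma scalar_prod_Cauchy_Schwarz:
  fixes x y :: "real vec"
  assumes "x \<in> carrier_vec n" "y \<in> carrier_vec n"
  shows "(x \<bullet> y)\<^sup>2 \<le> (x \<bullet> x) * (y \<bullet> y)"
proof (cases "x \<bullet> x = 0")
  case True
  then have "\<forall>i<n. x $ i = 0"
    using assms by (simp add: scalar_prod_def sum_nonneg_eq_0_iff)
  then have "x \<bullet> y = 0"
    using assms by (simp add: scalar_prod_def)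
  then show ?thesis using True by simp
next
  case False
  have "0 \<le> x \<bullet> x"
    by (simp add: scalar_prod_def sum_nonneg)
  with False have pos: "0 < x \<bullet> x" by simp
  \<comment> \<open>This is the squared length of \<open>x \<bullet> x\<close> times the component
    of \<open>y\<close> orthogonal to \<open>x\<close>; expanding it leaves a positive factor
    \<open>x \<bullet> x\<close> to cancel.\<close>
  have "0 \<le> (\<Sum>i<n. ((x \<bullet> x) * y $ i - (x \<bullet> y) * x $ i)\<^sup>2)"
    by (simp add: sum_nonneg)
  also have "\<dots> = (\<Sum>i<n. (x \<bullet> x)\<^sup>2 * (y $ i * y $ i)
      - 2 * (x \<bullet> x) * (x \<bullet> y) * (x $ i * y $ i) + (x \<bullet> y)\<^sup>2 * (x $ i * x $ i))"
    by (intro sum.cong) (simp_all add: power2_eq_square algebra_simps)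
  also have "\<dots> = (x \<bullet> x)\<^sup>2 * (y \<bullet> y) - 2 * (x \<bullet> x) * (x \<bullet> y) * (x \<bullet> y) + (x \<bullet> y)\<^sup>2 * (x \<bullet> x)"
  proof -
    have "(\<Sum>i<n. u $ i * v $ i) = u \<bullet> v" if "v \<in> carrier_vec n" for u v :: "real vec"
      using that by (simp add: scalar_prod_def atLeast0LessThan)
    then show ?thesis
      using assms by (simp only: sum.distrib sum_subtractf flip: sum_distrib_left)
  qed
  also have "\<dots> = (x \<bullet> x) * ((x \<bullet> x) * (y \<bullet> y) - (x \<bullet> y)\<^sup>2)"
    by (simp add: power2_eq_square algebra_simps)
  finally show ?thesis
    using pos by (simp add: zero_le_mult_iff)
qed

text \<open>Symmetry turns the form of \<open>B\<close> to the power \<open>2 * m\<close> at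
  \<open>x\<close> into the squared length of \<open>B ^\<^sub>m m *\<^sub>v x\<close>. By
  Cauchy-Schwarz, doubling the exponent therefore at least squares the quotient, which is why only
  exponents \<open>2 ^ j\<close> occur.\<close>

lemma Rayleigh_power:
  fixes B :: "real mat"
  assumes B: "B \<in> carrier_mat n n" and sym: "B\<^sup>T = B" and x: "x \<in> carrier_vec n"
    and r: "0 \<le> r" "r * (x \<bullet> x) \<le> x \<bullet> (B *\<^sub>v x)" and pos: "0 < x \<bullet> x"
  shows "r ^ (2 ^ j) * (x \<bullet> x) \<le> x \<bullet> (B ^\<^sub>m (2 ^ j) *\<^sub>v x)"
proof (induction j)
  case 0
  then show ?case using B r by simp
next
  case (Suc j)
  let ?m = "2 ^ j :: nat"
  let ?y = "B ^\<^sub>m ?m *\<^sub>v x"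
  have Bm: "B ^\<^sub>m ?m \<in> carrier_mat n n" using B by simp
  then have y: "?y \<in> carrier_vec n" using x by simp
  \<comment> \<open>Squaring preserves the induction hypothesis because \<open>r\<close> is
    nonnegative.\<close>
  have "(r ^ ?m * (x \<bullet> x))\<^sup>2 \<le> (x \<bullet> ?y)\<^sup>2"
    using Suc r pos by (intro power_mono) auto
  also have "\<dots> \<le> (x \<bullet> x) * (?y \<bullet> ?y)"
    by (rule scalar_prod_Cauchy_Schwarz[OF x y])
  also have "?y \<bullet> ?y = x \<bullet> (B ^\<^sub>m ?m *\<^sub>v ?y)"
    using transpose_vec_mult_scalar[OF Bm y x] transpose_pow_mat[OF B sym, of ?m] by simp
  also have "B ^\<^sub>m ?m *\<^sub>v ?y = B ^\<^sub>m (2 ^ Suc j) *\<^sub>v x"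
    using pow_mat_add[OF B, of ?m ?m] assoc_mult_mat_vec[OF Bm Bm x] by (simp add: mult_2)
  finally have "(x \<bullet> x) * (r ^ (2 ^ Suc j) * (x \<bullet> x))
      \<le> (x \<bullet> x) * (x \<bullet> (B ^\<^sub>m (2 ^ Suc j) *\<^sub>v x))"
    by (simp add: power_mult_distrib power2_eq_square mult_2 power_add mult_ac)
  then show ?case using pos by simp
qed

text \<open>Converts an entrywise bound into a bound on the form. The factor next to
  \<open>c\<close> depends on \<open>x\<close> only, so it stays fixed when \<open>B\<close> runs
  through the powers of a matrix.\<close>

lemma quadratic_form_le_norm_bound:
  fixes B :: "real mat"
  assumes B: "B \<in> carrier_mat n n" and x: "x \<in> carrier_vec n" and c: "norm_bound B c"
  shows "x \<bullet> (B *\<^sub>v x) \<le> c * (\<Sum>i<n. \<bar>x $ i\<bar>)\<^sup>2"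
proof -
  have "x \<bullet> (B *\<^sub>v x) = (\<Sum>i<n. \<Sum>j<n. B $$ (i, j) * (x $ i * x $ j))"
    using B x by (auto simp: scalar_prod_def atLeast0LessThan sum_distrib_left
        intro!: sum.cong)
  also have "\<dots> \<le> (\<Sum>i<n. \<Sum>j<n. c * (\<bar>x $ i\<bar> * \<bar>x $ j\<bar>))"
  proof (intro sum_mono)
    fix i j assume "i \<in> {..<n}" "j \<in> {..<n}"
    then have "\<bar>B $$ (i, j)\<bar> \<le> c"
      using B c by (auto simp: norm_bound_def)
    then have "\<bar>B $$ (i, j)\<bar> * \<bar>x $ i * x $ j\<bar> \<le> c * \<bar>x $ i * x $ j\<bar>"
      by (rule mult_right_mono) simp
    then show "B $$ (i, j) * (x $ i * x $ j) \<le> c * (\<bar>x $ i\<bar> * \<bar>x $ j\<bar>)"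
      by (metis abs_ge_self abs_mult order_trans)
  qed
  also have "\<dots> = c * (\<Sum>i<n. \<bar>x $ i\<bar>)\<^sup>2"
    by (simp only: power2_eq_square sum_product) (simp only: sum_distrib_left)
  finally show ?thesis .
qed

lemma Rayleigh_le_1:
  fixes B :: "real mat"
  assumes B: "B \<in> carrier_mat n n" and sym: "B\<^sup>T = B" and x: "x \<in> carrier_vec n"
    and pos: "0 < x \<bullet> x" and rad: "spectral_radius (map_mat complex_of_real B) < 1"
  shows "x \<bullet> (B *\<^sub>v x) \<le> x \<bullet> x"
proof (rule ccontr)
  assume gt: "\<not> ?thesis"
  define r where "r = x \<bullet> (B *\<^sub>v x) / (x \<bullet> x)"
  have r: "1 < r" "r * (x \<bullet> x) \<le> x \<bullet> (B *\<^sub>v x)"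
    using gt pos by (simp_all add: r_def)
  have BC: "map_mat complex_of_real B \<in> carrier_mat n n" using B by simp
  obtain c where c: "norm_bound (map_mat complex_of_real B ^\<^sub>m k) c" for k
    using spectral_radius_jnf_norm_bound_less_1_upper_triangular[OF BC rad] by blast
  \<comment> \<open>Embedding the reals into the complex numbers commutes with matrix powers and
    preserves absolute values, so the uniform \<open>c\<close> also serves the real powers.\<close>
  have c': "norm_bound (B ^\<^sub>m k) c" for k
    using c[of k] B unfolding of_real_hom.mat_hom_pow[OF B, symmetric]
    by (simp add: norm_bound_def)
  define C where "C = c * (\<Sum>i<n. \<bar>x $ i\<bar>)\<^sup>2"
  obtain j where j: "C / (x \<bullet> x) < r ^ j"
    using real_arch_pow[OF r(1)] by blast
  \<comment> \<open>The Archimedean property provides some exponent \<open>j\<close>; since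
    \<open>j \<le> 2 ^ j\<close> and \<open>r > 1\<close>, the available exponent
    \<open>2 ^ j\<close> works too.\<close>
  also have "r ^ j \<le> r ^ (2 ^ j)"
    using r(1) by (intro power_increasing) (simp_all add: less_imp_le)
  finally have "C < r ^ (2 ^ j) * (x \<bullet> x)"
    using pos by (simp add: field_simps)
  also have "\<dots> \<le> x \<bullet> (B ^\<^sub>m (2 ^ j) *\<^sub>v x)"
    using Rayleigh_power[OF B sym x _ r(2) pos] r(1) by simp
  also have "\<dots> \<le> C"
    unfolding C_def using quadratic_form_le_norm_bound[OF _ x c'] B by simp
  finally show False by simp
qed

lemma eigenvalue_smult_matD:
  fixes A :: "'a :: field mat"
  assumes A: "A \<in> carrier_mat n n" and "a \<noteq> 0" and "eigenvalue (a \<cdot>\<^sub>m A) k"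
  shows "eigenvalue A (k / a)"
proof -
  obtain v where v: "v \<in> carrier_vec n" "v \<noteq> 0\<^sub>v n" "a \<cdot>\<^sub>m A *\<^sub>v v = k \<cdot>\<^sub>v v"
    using assms unfolding eigenvalue_def eigenvector_def by auto
  have "a * (A *\<^sub>v v) $ i = k * v $ i" if "i < n" for i
    using arg_cong[OF v(3), of "\<lambda>w. w $ i"] that A v(1) by simp
  then have "A *\<^sub>v v = (k / a) \<cdot>\<^sub>v v"
    using A v(1) \<open>a \<noteq> 0\<close>
    by (intro eq_vecI) (auto simp: field_simps simp del: index_mult_mat_vec)
  then show ?thesis
    using v A unfolding eigenvalue_def eigenvector_def by auto
qed

text \<open>Scaling reduces this to \<open>Rayleigh_le_1\<close>: for \<open>s\<close> strictly
  between the spectral radius and a larger quotient, \<open>B\<close> divided by \<open>s\<close>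
  has spectral radius below 1 but a quotient above 1.\<close>

lemma Rayleigh_le_spectral_radius:
  fixes B :: "real mat"
  assumes B: "B \<in> carrier_mat n n" and sym: "B\<^sup>T = B" and x: "x \<in> carrier_vec n"
    and pos: "0 < x \<bullet> x"
  shows "x \<bullet> (B *\<^sub>v x) / (x \<bullet> x) \<le> spectral_radius (map_mat complex_of_real B)"
proof (rule ccontr)
  let ?A = "map_mat complex_of_real B"
  assume "\<not> ?thesis"
  then obtain s where s: "spectral_radius ?A < s" "s < x \<bullet> (B *\<^sub>v x) / (x \<bullet> x)"
    using dense by (meson not_le)
  \<comment> \<open>A positive dimension makes the spectrum nonempty, so that the spectral radius is
    an attained maximum.\<close>
  have n: "0 < n"
    using pos x by (cases n) (auto simp: scalar_prod_def)
  have A: "?A \<in> carrier_mat n n" using B by simp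
  have "0 \<le> spectral_radius ?A"
    using spectral_radius_mem_max(1)[OF A n] by auto
  with s have s0: "0 < s" by simp
  let ?D = "(1 / s) \<cdot>\<^sub>m B"
  have "B $$ (j, i) = B $$ (i, j)" if "i < n" "j < n" for i j
    using arg_cong[OF sym, of "\<lambda>A. A $$ (i, j)"] that B by simp
  then have D: "?D \<in> carrier_mat n n" "?D\<^sup>T = ?D"
    using B by (auto simp: mat_eq_iff)
  have DC: "map_mat complex_of_real ?D = complex_of_real (1 / s) \<cdot>\<^sub>m ?A"
    by (auto simp: mat_eq_iff)
  have "spectral_radius (map_mat complex_of_real ?D)
      \<in> norm ` spectrum (map_mat complex_of_real ?D)"
    using D by (intro spectral_radius_mem_max(1)[OF _ n]) simp
  then obtain k where k: "eigenvalue (complex_of_real (1 / s) \<cdot>\<^sub>m ?A) k"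
    "spectral_radius (map_mat complex_of_real ?D) = norm k"
    unfolding DC by (auto simp: spectrum_def)
  \<comment> \<open>Undoing the scaling: \<open>k * s\<close> is an eigenvalue of the original
    matrix, hence its modulus is at most the spectral radius, which is below
    \<open>s\<close>.\<close>
  have "eigenvalue ?A (k / complex_of_real (1 / s))"
    using eigenvalue_smult_matD[OF A _ k(1)] s0 by simp
  then have "norm (k / complex_of_real (1 / s)) \<le> spectral_radius ?A"
    by (intro spectral_radius_mem_max(2)[OF A n]) (auto simp: spectrum_def)
  then have "norm k * s \<le> spectral_radius ?A"
    using s0 by (simp add: norm_mult norm_divide)
  then have "norm k * s < 1 * s"
    using s(1) by linarith
  then have "spectral_radius (map_mat complex_of_real ?D) < 1"
    using s0 k(2) by (simp only: mult_less_cancel_right_pos)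
  from Rayleigh_le_1[OF D x pos this]
  have "x \<bullet> (?D *\<^sub>v x) \<le> x \<bullet> x" .
  moreover have "?D *\<^sub>v x = (1 / s) \<cdot>\<^sub>v (B *\<^sub>v x)"
    using B x by (auto simp: vec_eq_iff)
  ultimately have "x \<bullet> (B *\<^sub>v x) \<le> s * (x \<bullet> x)"
    using B x s0 by (simp add: field_simps)
  with s(2) pos show False by (simp add: field_simps)
qed

section \<open>Spectral radii of graphs\<close>

text \<open>The left-hand side is the Rayleigh quotient of the adjacency matrix at the all-ones
  vector, as every edge is stored as two arcs.\<close>

lemma average_degree_le_graph_spectral_radius:
  assumes "pair_graph G" and "pverts G \<noteq> {}"
  shows "real (card (parcs G)) / real (card (pverts G)) \<le> graph_spectral_radius G"
proof -
  interpret pair_graph G by fact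
  obtain vs where vs: "distinct vs" "set vs = pverts G"
    using finite_distinct_list[OF pair_finite_verts] by blast
  let ?n = "length vs"
  have n: "?n = card (pverts G)"
    using vs distinct_card by metis
  have n0: "0 < ?n" using assms(2) vs by auto
  define B :: "real mat" where
    "B = mat ?n ?n (\<lambda>(i, j). if (vs ! i, vs ! j) \<in> parcs G then 1 else 0)"
  let ?x = "vec ?n (\<lambda>_. 1) :: real vec"
  have B: "B \<in> carrier_mat ?n ?n" by (simp add: B_def)
  have "sym (parcs G)"
    using pair_sym_arcs by (simp add: symmetric_def)
  then have sym: "B\<^sup>T = B"
    by (auto simp: B_def mat_eq_iff sym_def)
  have A: "map_mat complex_of_real B = adjacency_mat G vs"
    by (auto simp: B_def adjacency_mat_def mat_eq_iff)
  have xx: "?x \<bullet> ?x = real ?n" by (simp add: scalar_prod_def)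
  have bij: "bij_betw ((!) vs) {0..<?n} (pverts G)"
    using vs by (auto intro: bij_betw_nth)
  have "?x \<bullet> (B *\<^sub>v ?x)
      = (\<Sum>i = 0..<?n. \<Sum>j = 0..<?n. if (vs ! i, vs ! j) \<in> parcs G then 1 else 0)"
    by (auto simp: scalar_prod_def B_def intro!: sum.cong)
  also have "\<dots> = (\<Sum>u\<in>pverts G. \<Sum>v\<in>pverts G. if (u, v) \<in> parcs G then 1 else 0)"
    by (simp add: sum.reindex_bij_betw[OF bij, symmetric])
  also have "\<dots> = (\<Sum>e\<in>pverts G \<times> pverts G. if e \<in> parcs G then 1 else 0)"
    by (simp add: sum.cartesian_product)
  also have "\<dots> = real (card (parcs G))"
  proof -
    have "pverts G \<times> pverts G \<inter> parcs G = parcs G"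
      by (auto dest: in_arcsD1 in_arcsD2)
    then show ?thesis
      by (simp add: pair_finite_verts flip: sum.inter_restrict)
  qed
  finally have "?x \<bullet> (B *\<^sub>v ?x) = real (card (parcs G))" .
  then have "real (card (parcs G)) / real ?n \<le> graph_spectral_radius G"
    using Rayleigh_le_spectral_radius[OF B sym, of ?x] n0
    by (simp only: xx A graph_spectral_radius_eq[OF vs] vec_carrier of_nat_0_less_iff)
  then show ?thesis by (simp only: n)
qed

text \<open>A nonzero eigenvalue of a complete bipartite graph has the product of the part sizes as
  its square, and this product is at most the square of \<open>n / 2\<close>.\<close>

lemma graph_spectral_radius_turan2_le:
  assumes "0 < n"
  shows "graph_spectral_radius (turan2 n) \<le> real n / 2"
proof -
  let ?vs = "[0..<n]" and ?h = "n div 2"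
  have carr: "adjacency_mat (turan2 n) ?vs \<in> carrier_mat n n"
    by (simp add: adjacency_mat_def)
  have "graph_spectral_radius (turan2 n) = spectral_radius (adjacency_mat (turan2 n) ?vs)"
    by (rule graph_spectral_radius_eq) (auto simp: turan2_def)
  then obtain k where eig: "eigenvalue (adjacency_mat (turan2 n) ?vs) k"
    and k: "graph_spectral_radius (turan2 n) = norm k"
    using spectral_radius_mem_max(1)[OF carr assms] by (auto simp: spectrum_def)
  from eig obtain f where f: "\<exists>v<n. f v \<noteq> 0"
    and f': "\<And>v. v < n \<Longrightarrow> (\<Sum>u<n. if (v, u) \<in> parcs (turan2 n) then f u else 0) = k * f v"
    unfolding eigenvalue_adjacency_mat[OF distinct_upt] by (auto simp: atLeast0LessThan)
  \<comment> \<open>An eigenvector enters the equations only through its sums over the two parts: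
    \<open>k * f v\<close> equals the sum over the part opposite to \<open>v\<close>.\<close>
  define P where "P = sum f {..<?h}"
  define Q where "Q = sum f {?h..<n}"
  have Q: "k * f v = Q" if "v < ?h" for v
  proof -
    have "{..<n} \<inter> {u. (v, u) \<in> parcs (turan2 n)} = {?h..<n}"
      using that by (auto simp: turan2_def)
    then show ?thesis
      using f'[of v] that by (simp add: Q_def sum.If_cases)
  qed
  have P: "k * f v = P" if "?h \<le> v" "v < n" for v
  proof -
    have "{..<n} \<inter> {u. (v, u) \<in> parcs (turan2 n)} = {..<?h}"
      using that by (auto simp: turan2_def)
    then show ?thesis
      using f'[of v] that by (simp add: P_def sum.If_cases)
  qed
  have kP: "k * P = of_nat ?h * Q"
    unfolding P_def sum_distrib_left using Q by simp
  have kQ: "k * Q = of_nat (n - ?h) * P"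
    unfolding Q_def sum_distrib_left using P by simp
  show ?thesis
  proof (cases "k = 0")
    case True
    then show ?thesis using k by simp
  next
    case False
    \<comment> \<open>For \<open>k \<noteq> 0\<close>, vanishing of \<open>P\<close> forces
      \<open>Q = 0\<close>, and then \<open>f\<close> vanishes on both parts.\<close>
    have "P \<noteq> 0"
    proof
      assume "P = 0"
      then have "Q = 0" using kQ False by simp
      obtain v where "v < n" "f v \<noteq> 0" using f by blast
      then show False
        using P[of v] Q[of v] \<open>P = 0\<close> \<open>Q = 0\<close> False by (cases "v < ?h") auto
    qed
    have "k * k * P = of_nat (?h * (n - ?h)) * P"
      using kP kQ by (metis mult.assoc mult.left_commute of_nat_mult)
    then have "k * k = of_nat (?h * (n - ?h))"
      using \<open>P \<noteq> 0\<close> by simp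
    then have "(norm k)\<^sup>2 = real (?h * (n - ?h))"
      by (metis norm_mult norm_of_nat power2_eq_square)
    also have "\<dots> = real ?h * (real n - real ?h)"
      by (simp add: of_nat_diff)
    also have "\<dots> \<le> (real n / 2)\<^sup>2"
      using zero_le_power2[of "real n / 2 - real ?h"]
      by (simp add: power2_eq_square algebra_simps)
    finally show ?thesis
      unfolding k by (rule power2_le_imp_le) simp
  qed
qed

section \<open>Tight graphs\<close>

context pair_graph
begin

lemma neighbourhood_sym: "u \<in> neighbourhood G v \<longleftrightarrow> v \<in> neighbourhood G u"
  using pair_sym_arcs by (auto simp: neighbourhood_def symmetric_def sym_def)

lemma parcs_sym: "(u, v) \<in> parcs G \<longleftrightarrow> (v, u) \<in> parcs G"
  using neighbourhood_sym by (auto simp: neighbourhood_def)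

lemma neighbourhood_subset: "neighbourhood G v \<subseteq> pverts G"
  by (auto simp: neighbourhood_def dest: in_arcsD2)

lemma finite_neighbourhood: "finite (neighbourhood G v)"
  using neighbourhood_subset pair_finite_verts by (rule finite_subset)

lemma card_parcs: "card (parcs G) = (\<Sum>v\<in>pverts G. card (neighbourhood G v))"
proof -
  have "parcs G = (SIGMA v:pverts G. neighbourhood G v)"
    by (auto simp: neighbourhood_def dest: in_arcsD1)
  then show ?thesis
    using pair_finite_verts finite_neighbourhood by simp
qed

text \<open>The map from arcs to their end sets has fibres of size exactly two, since loops are
  absent.\<close>

lemma card_parcs_eq_num_edges: "card (parcs G) = 2 * num_edges G"
proof -
  let ?arcs = "\<lambda>e. {a \<in> parcs G. {fst a, snd a} = e}"
  have "edge_set G = (\<lambda>a. {fst a, snd a}) ` parcs G"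
    by (force simp: edge_set_def)
  then have "card (parcs G) = (\<Sum>e\<in>edge_set G. card (?arcs e))"
    using pair_finite_arcs sum.image_gen[of "parcs G" "\<lambda>_. 1::nat" "\<lambda>a. {fst a, snd a}"] by simp
  also have "\<dots> = (\<Sum>e\<in>edge_set G. 2)"
  proof (rule sum.cong)
    fix e assume "e \<in> edge_set G"
    then obtain u v where uv: "e = {u, v}" "(u, v) \<in> parcs G"
      by (auto simp: edge_set_def)
    then have "?arcs e = {(u, v), (v, u)}"
      using parcs_sym by (auto simp: doubleton_eq_iff)
    then show "card (?arcs e) = 2"
      using no_loops'[OF uv(2)] by simp
  qed simp
  finally show ?thesis by (simp add: num_edges_def)
qed

text \<open>A triangle on the edge is determined by its third vertex. This translates the triangle
  counts in \<open>tight\<close> into codegrees.\<close>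

lemma card_triangles_containing:
  assumes uv: "(u, v) \<in> parcs G"
  shows "card {T. is_triangle G T \<and> {u, v} \<subseteq> T} = card (neighbourhood G u \<inter> neighbourhood G v)"
proof -
  have ne: "u \<noteq> v" using uv by (rule no_loops')
  let ?f = "\<lambda>x. {u, v, x}"
  have "{T. is_triangle G T \<and> {u, v} \<subseteq> T} = ?f ` (neighbourhood G u \<inter> neighbourhood G v)"
  proof (intro equalityI subsetI)
    fix T assume T: "T \<in> {T. is_triangle G T \<and> {u, v} \<subseteq> T}"
    then have fin: "finite T" by (auto simp: is_triangle_def intro: card_ge_0_finite)
    then have "card (T - {u, v}) = 1"
      using T ne by (simp add: card_Diff_subset is_triangle_def)
    then obtain x where x: "T - {u, v} = {x}" by (auto simp: card_1_singleton_iff)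
    then have "T = {u, v, x}" using T by blast
    moreover have "x \<noteq> u" "x \<noteq> v" using x by auto
    ultimately show "T \<in> ?f ` (neighbourhood G u \<inter> neighbourhood G v)"
      using T by (auto simp: is_triangle_def neighbourhood_def)
  next
    fix T assume "T \<in> ?f ` (neighbourhood G u \<inter> neighbourhood G v)"
    then obtain x where x: "T = {u, v, x}" "(u, x) \<in> parcs G" "(v, x) \<in> parcs G"
      by (auto simp: neighbourhood_def)
    then show "T \<in> {T. is_triangle G T \<and> {u, v} \<subseteq> T}"
      using uv ne no_loops'[OF x(2)] no_loops'[OF x(3)] parcs_sym
      by (auto simp: is_triangle_def dest: in_arcsD1 in_arcsD2)
  qed
  moreover have "inj_on ?f (neighbourhood G u \<inter> neighbourhood G v)"
    by (auto simp: inj_on_def neighbourhood_def dest: no_loops')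
  ultimately show ?thesis by (simp add: card_image)
qed

end

lemma is_triangleE:
  assumes "is_triangle F T"
  obtains a b c where "T = {a, b, c}" "a \<noteq> b" "a \<noteq> c" "b \<noteq> c"
    "(a, b) \<in> parcs F" "(a, c) \<in> parcs F" "(b, c) \<in> parcs F"
proof -
  obtain a b c where "T = {a, b, c}" "a \<noteq> b" "a \<noteq> c" "b \<noteq> c"
    using assms by (auto simp: is_triangle_def card_3_iff)
  with assms that show thesis by (auto simp: is_triangle_def)
qed

text \<open>Tightness in integers: with \<open>m\<close> equal to N/6, the real quotients N/2 and
  N/6 become \<open>3 * m\<close> and \<open>m\<close>.\<close>

locale tight_graph = pair_graph +
  fixes m :: nat
  assumes card_pverts: "card (pverts G) = 6 * m"
    and degree: "v \<in> pverts G \<Longrightarrow> card (neighbourhood G v) = 3 * m"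
    and codegree: "(u, v) \<in> parcs G \<Longrightarrow>
      card (neighbourhood G u \<inter> neighbourhood G v) \<in> {0, m}"

lemma tightE:
  assumes "pair_graph F" and "tight F"
  obtains m where "tight_graph F m"
proof -
  interpret pair_graph F by fact
  let ?cod = "\<lambda>u v. card (neighbourhood F u \<inter> neighbourhood F v)"
  have cod: "?cod u v = 0 \<or> 6 * ?cod u v = card (pverts F)" if "(u, v) \<in> parcs F" for u v
  proof -
    have "{u, v} \<in> edge_set F" using that by (auto simp: edge_set_def)
    then have "?cod u v = 0 \<or> real (?cod u v) = real (card (pverts F)) / 6"
      using assms(2) unfolding tight_def card_triangles_containing[OF that, symmetric] by blast
    then show ?thesis by linarith
  qed
  obtain T where "is_triangle F T" using assms(2) by (auto simp: tight_def)
  then obtain a b c where abc: "(a, b) \<in> parcs F" "(a, c) \<in> parcs F" "(b, c) \<in> parcs F"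
    by (rule is_triangleE)
  \<comment> \<open>Taking \<open>m\<close> as the codegree of an edge in a triangle yields
    divisibility by 6: this codegree counts \<open>c\<close>, so it is nonzero and must be exactly
    N/6.\<close>
  define m where "m = ?cod a b"
  have "m \<noteq> 0"
    using abc finite_neighbourhood by (auto simp: m_def neighbourhood_def)
  with cod[OF abc(1)] have N: "card (pverts F) = 6 * m"
    by (simp add: m_def)
  have "tight_graph F m"
  proof unfold_locales
    show "card (neighbourhood F v) = 3 * m" if "v \<in> pverts F" for v
    proof -
      have "real (card (neighbourhood F v)) = real (6 * m) / 2"
        using assms(2) that N by (simp add: tight_def)
      then show ?thesis by linarith
    qed
    show "?cod u v \<in> {0, m}" if "(u, v) \<in> parcs F" for u v
      using cod[OF that] N by auto
  qed (fact N)
  then show thesis by (rule that)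
qed

context tight_graph
begin

lemma codegree_triangle:
  assumes "(a, b) \<in> parcs G" "(a, c) \<in> parcs G" "(b, c) \<in> parcs G"
  shows "card (neighbourhood G a \<inter> neighbourhood G b) = m"
proof -
  have "c \<in> neighbourhood G a \<inter> neighbourhood G b"
    using assms by (simp add: neighbourhood_def)
  then show ?thesis
    using codegree[OF assms(1)] finite_neighbourhood by auto
qed

text \<open>By inclusion-exclusion the neighbourhoods of the vertices of a triangle cover
  \<open>3 \<cdot> N/2 - 3 \<cdot> N/6 = N\<close> vertices plus the common neighbours.\<close>

lemma no_K4:
  assumes "(a, b) \<in> parcs G" "(a, c) \<in> parcs G" "(b, c) \<in> parcs G"
  shows "neighbourhood G a \<inter> neighbourhood G b \<inter> neighbourhood G c = {}"
proof -
  let ?A = "neighbourhood G a" and ?B = "neighbourhood G b" and ?C = "neighbourhood G c"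
  note fin = finite_neighbourhood
  have "card ?A = 3 * m" "card ?B = 3 * m" "card ?C = 3 * m"
    using assms by (auto intro!: degree dest: in_arcsD1 in_arcsD2)
  moreover have "card (?A \<inter> ?B) = m" "card (?A \<inter> ?C) = m" "card (?B \<inter> ?C) = m"
    using assms parcs_sym by (blast intro: codegree_triangle)+
  moreover have "card (?A \<union> ?B \<union> ?C) \<le> 6 * m"
    unfolding card_pverts[symmetric] using neighbourhood_subset
    by (intro card_mono) (auto simp: pair_finite_verts)
  moreover have "card ?A + card ?B = card (?A \<union> ?B) + card (?A \<inter> ?B)"
    by (intro card_Un_Int fin)
  moreover have "card (?A \<union> ?B) + card ?C = card (?A \<union> ?B \<union> ?C) + card ((?A \<union> ?B) \<inter> ?C)"
    by (intro card_Un_Int) (simp_all add: fin)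
  moreover have "card (?A \<inter> ?C) + card (?B \<inter> ?C)
      = card ((?A \<union> ?B) \<inter> ?C) + card (?A \<inter> ?B \<inter> ?C)"
    using card_Un_Int[of "?A \<inter> ?C" "?B \<inter> ?C"] fin by (simp add: Int_Un_distrib Int_ac)
  ultimately have "card (?A \<inter> ?B \<inter> ?C) = 0" by linarith
  then show ?thesis using fin by simp
qed

text \<open>Two common neighbours in \<open>T\<close> would be adjacent and form a complete graph on
  four vertices with \<open>u\<close> and \<open>v\<close>, against \<open>no_K4\<close>.\<close>

lemma card_triangle_Int_neighbourhoods:
  assumes T: "is_triangle G T" and uv: "(u, v) \<in> parcs G"
  shows "card (T \<inter> (neighbourhood G u \<inter> neighbourhood G v)) \<le> 1"
proof (rule ccontr)
  let ?S = "T \<inter> (neighbourhood G u \<inter> neighbourhood G v)"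
  assume "\<not> ?thesis"
  moreover have "finite ?S" using finite_neighbourhood by simp
  ultimately have "\<not> (\<forall>a\<in>?S. \<forall>b\<in>?S. a = b)"
    using card_le_Suc0_iff_eq[of ?S] by simp
  then obtain a b where ab: "a \<in> T" "b \<in> T" "a \<noteq> b"
    "a \<in> neighbourhood G u \<inter> neighbourhood G v" "b \<in> neighbourhood G u \<inter> neighbourhood G v"
    by blast
  then have "(a, b) \<in> parcs G" using T by (auto simp: is_triangle_def)
  then have "b \<in> neighbourhood G u \<inter> neighbourhood G v \<inter> neighbourhood G a"
    using ab by (simp add: neighbourhood_def)
  then show False
    using no_K4[OF uv, of a] ab by (auto simp: neighbourhood_def)
qed

end

section \<open>Counting in the blow-up along a triangle\<close>

abbreviation (input) weight :: "'a set \<Rightarrow> nat \<Rightarrow> 'a \<Rightarrow> nat" where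
  "weight T t v \<equiv> if v \<in> T then t + 1 else t"

text \<open>Each vertex gives \<open>t\<close> copies, and one more if it lies in \<open>T\<close>.
  All sizes in the blow-up reduce to sizes in the base graph this way.\<close>

lemma sum_weight:
  assumes "finite S"
  shows "(\<Sum>v\<in>S. weight T t v) = t * card S + card (T \<inter> S)"
proof -
  have "(\<Sum>v\<in>S. weight T t v) = (\<Sum>v\<in>S. t + (if v \<in> T then 1 else 0))"
    by (intro sum.cong) auto
  then show ?thesis
    using assms by (simp add: sum.distrib Int_commute flip: sum.inter_restrict)
qed

text \<open>The bound on \<open>i\<close> says that copy \<open>i\<close> of \<open>u\<close>
  exists; otherwise the left-hand side would be empty.\<close>

lemma neighbourhood_blow_up:
  assumes "i < w u"
  shows "neighbourhood (blow_up F w) (u, i) = (SIGMA v:neighbourhood F u. {..<w v})"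
  using assms by (auto simp: neighbourhood_def blow_up_def)

context tight_graph
begin

lemma card_pverts_blow_up:
  assumes "is_triangle G T"
  shows "card (pverts (blow_up G (weight T t))) = 6 * m * t + 3"
proof -
  have "T \<inter> pverts G = T" "card T = 3"
    using assms by (auto simp: is_triangle_def)
  then show ?thesis
    using pair_finite_verts by (simp add: blow_up_def sum_weight card_pverts)
qed

text \<open>Double counting of the arcs that end in \<open>T\<close>: each of its three vertices has
  degree \<open>3 * m\<close>.\<close>

lemma sum_card_triangle_Int_neighbourhood:
  assumes "is_triangle G T"
  shows "(\<Sum>u\<in>pverts G. card (T \<inter> neighbourhood G u)) = 9 * m"
proof -
  have T: "T \<subseteq> pverts G" "card T = 3" using assms by (auto simp: is_triangle_def)
  have finT: "finite T" using T pair_finite_verts finite_subset by blast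
  have "(\<Sum>u\<in>pverts G. card (T \<inter> neighbourhood G u))
      = (\<Sum>u\<in>pverts G. \<Sum>v\<in>T. if v \<in> neighbourhood G u then 1 else 0)"
    using finT by (simp flip: sum.inter_restrict)
  also have "\<dots> = (\<Sum>v\<in>T. \<Sum>u\<in>pverts G. if u \<in> neighbourhood G v then 1 else 0)"
    by (subst sum.swap) (intro sum.cong if_cong neighbourhood_sym refl)
  also have "\<dots> = (\<Sum>v\<in>T. card (pverts G \<inter> neighbourhood G v))"
    using pair_finite_verts by (simp flip: sum.inter_restrict)
  also have "\<dots> = (\<Sum>v\<in>T. 3 * m)"
    using T neighbourhood_subset by (intro sum.cong) (auto simp: Int_absorb1 degree)
  finally show ?thesis using T by simp
qed

lemma card_triangle_Int_neighbourhood: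
  assumes T: "is_triangle G T" and u: "u \<in> T"
  shows "card (T \<inter> neighbourhood G u) = 2"
proof -
  have "T \<inter> neighbourhood G u = T - {u}"
    using assms by (auto simp: is_triangle_def neighbourhood_def dest: no_loops')
  then show ?thesis using assms by (simp add: is_triangle_def)
qed

text \<open>Every copy of \<open>u\<close> has degree \<open>3 * m * t + d\<close>, where
  \<open>d\<close> counts the neighbours of \<open>u\<close> in \<open>T\<close>. The first part
  sums to \<open>(6 * m * t + 3) * (3 * m * t)\<close>; the second to \<open>9 * m * t\<close>, plus
  2 for the extra copy of each vertex of \<open>T\<close>.\<close>

lemma card_parcs_blow_up:
  assumes T: "is_triangle G T"
  shows "card (parcs (blow_up G (weight T t))) = 18 * m\<^sup>2 * t\<^sup>2 + 18 * m * t + 6"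
proof -
  let ?w = "weight T t" and ?d = "\<lambda>u. card (T \<inter> neighbourhood G u)"
  interpret B: pair_graph "blow_up G ?w" by (intro pair_graph_blow_up) unfold_locales
  have T': "T \<subseteq> pverts G" "card T = 3" using T by (auto simp: is_triangle_def)
  have "card (parcs (blow_up G ?w))
      = (\<Sum>p\<in>(SIGMA u:pverts G. {..<?w u}). card (neighbourhood (blow_up G ?w) p))"
    unfolding B.card_parcs by (simp add: blow_up_def)
  also have "\<dots> = (\<Sum>u\<in>pverts G. \<Sum>i<?w u. card (neighbourhood (blow_up G ?w) (u, i)))"
    using pair_finite_verts by (subst sum.Sigma) auto
  also have "\<dots> = (\<Sum>u\<in>pverts G. \<Sum>i<?w u. 3 * m * t + ?d u)"
  proof (intro sum.cong refl)
    fix u i assume u: "u \<in> pverts G" and i: "i \<in> {..<?w u}"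
    have "card (neighbourhood (blow_up G ?w) (u, i)) = (\<Sum>v\<in>neighbourhood G u. ?w v)"
      using i finite_neighbourhood by (subst neighbourhood_blow_up) auto
    then show "card (neighbourhood (blow_up G ?w) (u, i)) = 3 * m * t + ?d u"
      using u finite_neighbourhood by (simp add: sum_weight degree)
  qed
  \<comment> \<open>The weight is split into \<open>t\<close> and the indicator of \<open>T\<close>
    only where it multiplies \<open>?d u\<close>; elsewhere it sums to the number of
    vertices.\<close>
  also have "\<dots> = (\<Sum>u\<in>pverts G. ?w u * (3 * m * t) + (t * ?d u + (if u \<in> T then ?d u else 0)))"
    by (intro sum.cong) (auto simp: algebra_simps)
  also have "\<dots> = (\<Sum>u\<in>pverts G. ?w u) * (3 * m * t)
      + (t * (\<Sum>u\<in>pverts G. ?d u) + (\<Sum>u\<in>pverts G \<inter> T. ?d u))"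
    unfolding sum.distrib sum_distrib_left sum_distrib_right
      sum.inter_restrict[OF pair_finite_verts] ..
  also have "(\<Sum>u\<in>pverts G \<inter> T. ?d u) = 6"
    using T' card_triangle_Int_neighbourhood[OF T] by (simp add: Int_absorb1)
  also have "(\<Sum>u\<in>pverts G. ?w u) = 6 * m * t + 3"
    using T' pair_finite_verts by (simp add: sum_weight card_pverts Int_absorb2)
  also have "(\<Sum>u\<in>pverts G. ?d u) = 9 * m"
    by (rule sum_card_triangle_Int_neighbourhood[OF T])
  finally show ?thesis by (simp add: power2_eq_square algebra_simps)
qed

lemma card_common_neighbourhood_blow_up:
  assumes "i < weight T t u" "j < weight T t v"
  shows "card (neighbourhood (blow_up G (weight T t)) (u, i)
      \<inter> neighbourhood (blow_up G (weight T t)) (v, j))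
    = t * card (neighbourhood G u \<inter> neighbourhood G v)
      + card (T \<inter> (neighbourhood G u \<inter> neighbourhood G v))"
proof -
  let ?S = "neighbourhood G u \<inter> neighbourhood G v"
  have fin: "finite ?S" using finite_neighbourhood by simp
  have "neighbourhood (blow_up G (weight T t)) (u, i)
      \<inter> neighbourhood (blow_up G (weight T t)) (v, j) = (SIGMA x:?S. {..<weight T t x})"
    using assms by (subst (1 2) neighbourhood_blow_up) auto
  then show ?thesis
    using fin by (simp add: sum_weight)
qed

lemma booksize_blow_up:
  assumes T: "is_triangle G T"
  shows "booksize (blow_up G (weight T t)) = m * t + 1"
proof -
  let ?B = "blow_up G (weight T t)"
  interpret B: pair_graph ?B by (intro pair_graph_blow_up) unfold_locales
  show ?thesis
    unfolding booksize_def
  proof (rule Max_eqI)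
    show "finite ((\<lambda>(p, q). card (neighbourhood ?B p \<inter> neighbourhood ?B q)) ` parcs ?B)"
      using B.pair_finite_arcs by simp
  next
    fix y assume "y \<in> (\<lambda>(p, q). card (neighbourhood ?B p \<inter> neighbourhood ?B q)) ` parcs ?B"
    then obtain u i v j where y: "y = card (neighbourhood ?B (u, i) \<inter> neighbourhood ?B (v, j))"
      and arc: "((u, i), (v, j)) \<in> parcs ?B" by auto
    then have uv: "(u, v) \<in> parcs G" "i < weight T t u" "j < weight T t v"
      by (auto simp: blow_up_def)
    have "card (neighbourhood G u \<inter> neighbourhood G v) \<le> m"
      using codegree[OF uv(1)] by auto
    then have "t * card (neighbourhood G u \<inter> neighbourhood G v) \<le> m * t"
      by simp
    then show "y \<le> m * t + 1"
      unfolding y card_common_neighbourhood_blow_up[OF uv(2,3)]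
      using card_triangle_Int_neighbourhoods[OF T uv(1)] by (rule add_mono)
  next
    \<comment> \<open>The bound is attained between copies of two vertices of \<open>T\<close>:
      their codegree is \<open>m\<close>, and the third vertex is their one common neighbour in
      \<open>T\<close>.\<close>
    obtain a b c where abc: "T = {a, b, c}" "a \<noteq> b" "a \<noteq> c" "b \<noteq> c"
      "(a, b) \<in> parcs G" "(a, c) \<in> parcs G" "(b, c) \<in> parcs G"
      using T by (rule is_triangleE)
    have "T \<inter> (neighbourhood G a \<inter> neighbourhood G b) = {c}"
      using abc by (auto simp: neighbourhood_def dest: no_loops')
    \<comment> \<open>Copy 0 exists, as the vertices of \<open>T\<close> have weight
      \<open>t + 1\<close>.\<close>
    moreover have "0 < weight T t a" "0 < weight T t b" using abc by auto
    ultimately have "card (neighbourhood ?B (a, 0) \<inter> neighbourhood ?B (b, 0)) = m * t + 1"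
      using card_common_neighbourhood_blow_up[of 0 a T t 0 b] codegree_triangle[OF abc(5-7)]
      by simp
    moreover have "((a, 0), (b, 0)) \<in> parcs ?B"
      using abc by (auto simp: blow_up_def)
    ultimately show
      "m * t + 1 \<in> (\<lambda>(p, q). card (neighbourhood ?B p \<inter> neighbourhood ?B q)) ` parcs ?B"
      by force
  qed
qed

end

section \<open>From the counts to order, size, booksize and spectral radius\<close>

theorem proposition3p13:
  fixes F :: "'a pair_pre_digraph" and T :: "'a set" and t N n :: nat
    and G :: "('a \<times> nat) pair_pre_digraph"
  assumes "pair_graph F" and "tight F" and "N = card (pverts F)"
    and "is_triangle F T" and "t \<ge> 1"
    and "G = blow_up F (\<lambda>v. if v \<in> T then t + 1 else t)"
    and "n = card (pverts G)"
  shows "n = N * t + 3 \<and>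
    num_edges G = n\<^sup>2 div 4 + 1 \<and>
    booksize G = n div 6 + 1 \<and>
    graph_spectral_radius G > graph_spectral_radius (turan2 n)"
proof -
  obtain m where "tight_graph F m"
    using assms(1,2) by (rule tightE)
  then interpret tight_graph F m .
  have pg: "pair_graph G"
    unfolding assms(6) using assms(1) by (rule pair_graph_blow_up)
  have n: "n = 6 * (m * t) + 3"
    using card_pverts_blow_up[OF assms(4), of t] assms(6,7) by simp
  have arcs: "card (parcs G) = 18 * m\<^sup>2 * t\<^sup>2 + 18 * m * t + 6"
    using card_parcs_blow_up[OF assms(4), of t] assms(6) by simp
  have "n = N * t + 3"
    using n assms(3) card_pverts by simp
  moreover have "num_edges G = n\<^sup>2 div 4 + 1"
  proof -
    have "num_edges G = 9 * (m * t)\<^sup>2 + 9 * (m * t) + 3"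
      using pair_graph.card_parcs_eq_num_edges[OF pg] arcs by (simp add: power_mult_distrib)
    \<comment> \<open>As \<open>n\<close> is odd, its square leaves remainder 1 modulo 4, and the
      quotient is one less than the edge count.\<close>
    moreover have "n\<^sup>2 = 4 * (9 * (m * t)\<^sup>2 + 9 * (m * t) + 2) + 1"
      unfolding n by (simp add: power2_eq_square algebra_simps)
    ultimately show ?thesis by simp
  qed
  moreover have "booksize G = n div 6 + 1"
    \<comment> \<open>Since \<open>n\<close> is 3 modulo 6, \<open>n div 6\<close> is
      \<open>m * t\<close>.\<close>
    using booksize_blow_up[OF assms(4), of t] assms(6) n by simp
  moreover have "graph_spectral_radius (turan2 n) < graph_spectral_radius G"
  proof -
    have "0 < n" using n by simp
    then have "graph_spectral_radius (turan2 n) \<le> real n / 2"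
      by (rule graph_spectral_radius_turan2_le)
    also have "\<dots> < real (card (parcs G)) / real n"
    proof -
      \<comment> \<open>The two sides differ by exactly 3, which makes the average degree exceed
        \<open>n / 2\<close> strictly.\<close>
      have "n * n < 2 * card (parcs G)"
        unfolding arcs n by (simp add: power2_eq_square algebra_simps)
      then have "real n * real n < 2 * real (card (parcs G))"
        by (metis of_nat_less_iff of_nat_mult of_nat_numeral)
      then show ?thesis using \<open>0 < n\<close> by (simp add: field_simps)
    qed
    also have "\<dots> \<le> graph_spectral_radius G"
      unfolding assms(7) using \<open>0 < n\<close> assms(7)
      by (intro average_degree_le_graph_spectral_radius pg) auto
    finally show ?thesis .
  qed
  ultimately show ?thesis by simp
qed

end
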